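(* Let $V\in\mathbb{R}^{n\times n}$ be a nonsingular covariance matrix (symmetric positive definite), let $\eta=\operatorname{diag}(V)$, and let $$\rho:=\sqrt{\eta^\top V^{-1}\eta-\frac{(\mathbf 1_n^\top V^{-1}\eta)^2}{\mathbf 1_n^\top V^{-1}\mathbf 1_n}} .$$ Let $\sigma\ge\sigma_{\mathrm{mvp}}$. Then the optimal diversification return portfolio $\mathbf w(\sigma)$ of the problem $$\mathbf w(\sigma):=\arg\max\ q(\mathbf w)\quad\text{s.t.}\quad \mathbf 1_n^\top\mathbf w=1,\ \ \mathbf w^\top V\mathbf w=\sigma^2$$ is given by $$\mathbf w(\sigma)=\alpha\,\mathbf w_{\mathrm{mdrp}}+(1-\alpha)\,\mathbf w_{\mathrm{mvp}},\qquad \text{with}\quad \alpha:=\frac{2}{\rho}\sqrt{\sigma^2-\sigma_{\mathrm{mvp}}^2} .$$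
   Context: $\mathbf 1_n\in\mathbb{R}^n$ is the all-ones column vector and $\operatorname{diag}(V)$ is the column vector of diagonal entries of $V$. The diversification return of a portfolio $\mathbf w\in\mathbb{R}^n$ with $\mathbf 1_n^\top\mathbf w=1$ is $q(\mathbf w)=\tfrac12(\eta^\top\mathbf w-\mathbf w^\top V\mathbf w)$. The minimum variance portfolio is $\mathbf w_{\mathrm{mvp}}=V^{-1}\mathbf 1_n/(\mathbf 1_n^\top V^{-1}\mathbf 1_n)$, with variance $\sigma_{\mathrm{mvp}}^2=1/(\mathbf 1_n^\top V^{-1}\mathbf 1_n)$, $\sigma_{\mathrm{mvp}}>0$. The maximum diversification return portfolio is $$\mathbf w_{\mathrm{mdrp}}=\frac{D^{-1}\mathbf 1_n}{\mathbf 1_n^\top D^{-1}\mathbf 1_n}=\Big(1-\frac{\mathbf 1_n^\top V^{-1}\eta}{2}\Big)\frac{V^{-1}\mathbf 1_n}{\mathbf 1_n^\top V^{-1}\mathbf 1_n}+\frac12V^{-1}\eta,$$ where $D=\tfrac12(\eta\mathbf 1_n^\top+\mathbf 1_n\eta^\top)-V$, which is nonsingular as a consequence of the nonsingularity of $V$.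
   Formalization: The formal statement additionally assumes ρ ≠ 0 (the variances in η are not all equal, so n ≥ 2); when ρ = 0 the coefficient α = (2/ρ)√(σ²−σ_mvp²) is undefined, and for σ > σ_mvp the diversification return is constant on the feasible set. *)

theory Defs
  imports "HOL-Analysis.Analysis"
begin

definition sym_pos_def :: "real^'n^'n \<Rightarrow> bool"
  where "sym_pos_def V \<longleftrightarrow> transpose V = V \<and> (\<forall>x. x \<noteq> 0 \<longrightarrow> 0 < x \<bullet> (V *v x))"

definition ones :: "real^'n"
  where "ones = (\<chi> i. 1)"

definition diag_vec :: "real^'n^'n \<Rightarrow> real^'n"
  where "diag_vec V = (\<chi> i. V $ i $ i)"

definition div_return :: "real^'n^'n \<Rightarrow> real^'n \<Rightarrow> real"
  where "div_return V w = 1/2 * (diag_vec V \<bullet> w - w \<bullet> (V *v w))"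

definition w_mvp :: "real^'n^'n \<Rightarrow> real^'n"
  where "w_mvp V = (1 / (ones \<bullet> (matrix_inv V *v ones))) *\<^sub>R (matrix_inv V *v ones)"

definition sigma_mvp :: "real^'n^'n \<Rightarrow> real"
  where "sigma_mvp V = sqrt (1 / (ones \<bullet> (matrix_inv V *v ones)))"

(* The constraints to real^1^'n make the products outer products of vectors:
   columnvector and rowvector are polymorphic in the second dimension. *)
definition D_mat :: "real^'n^'n \<Rightarrow> real^'n^'n"
  where "D_mat V =
    (1/2) *\<^sub>R ((columnvector (diag_vec V) :: real^1^'n) ** rowvector ones
             + (columnvector ones :: real^1^'n) ** rowvector (diag_vec V)) - V"

(* D_mat V is invertible for sym_pos_def V only if CARD('n) \<ge> 2;
   for CARD('n) = 1 it is the zero matrix. *)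
definition w_mdrp :: "real^'n^'n \<Rightarrow> real^'n"
  where "w_mdrp V = (1 / (ones \<bullet> (matrix_inv (D_mat V) *v ones)))
                      *\<^sub>R (matrix_inv (D_mat V) *v ones)"

definition rho :: "real^'n^'n \<Rightarrow> real"
  where "rho V = sqrt (diag_vec V \<bullet> (matrix_inv V *v diag_vec V)
                   - (ones \<bullet> (matrix_inv V *v diag_vec V))\<^sup>2 / (ones \<bullet> (matrix_inv V *v ones)))"

end

theory Submission
  imports Defs
begin

text \<open>
  There is a direction \<open>u\<close> with zero coordinate sum such that
  \<open>x \<bullet> V u = \<eta> \<bullet> x / 2\<close> whenever \<open>x\<close> has zero coordinate sum, and \<open>w_mdrp = w_mvp + u\<close>.
  A feasible portfolio is \<open>w_mvp + x\<close> with \<open>x \<bullet> V x = \<sigma>\<^sup>2 - \<sigma>_mvp\<^sup>2\<close>, and maximising the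
  diversification return amounts to maximising \<open>x \<bullet> V u\<close> on this \<open>V\<close>-sphere.  The
  Cauchy-Schwarz inequality for the inner product \<open>V\<close> and its equality case give \<open>x = \<alpha> u\<close>.
\<close>

section \<open>Positive definite forms and matrix inverses\<close>

lemma sym_pos_def_inner_commute:
  fixes V :: "real^'n^'n"
  assumes "sym_pos_def V"
  shows "x \<bullet> (V *v y) = y \<bullet> (V *v x)"
  using assms by (metis dot_lmul_matrix inner_commute sym_pos_def_def transpose_matrix_vector)

lemma sym_pos_def_nonneg: "sym_pos_def V \<Longrightarrow> 0 \<le> x \<bullet> (V *v x)"
  unfolding sym_pos_def_def by (cases "x = 0") (auto simp: less_imp_le)

lemma sym_pos_def_eq_0_iff: "sym_pos_def V \<Longrightarrow> x \<bullet> (V *v x) = 0 \<longleftrightarrow> x = 0"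
  unfolding sym_pos_def_def by (cases "x = 0") (auto simp: less_le)

lemma sym_pos_def_quadratic_add:
  fixes V :: "real^'n^'n"
  assumes "sym_pos_def V"
  shows "(x + t *\<^sub>R y) \<bullet> (V *v (x + t *\<^sub>R y))
    = x \<bullet> (V *v x) + 2 * t * (x \<bullet> (V *v y)) + t\<^sup>2 * (y \<bullet> (V *v y))"
  using sym_pos_def_inner_commute[OF assms, of y x]
  by (simp add: matrix_vector_right_distrib matrix_vector_mult_scaleR inner_add_left
      inner_add_right algebra_simps power2_eq_square)

lemma invertible_if_kernel_trivial:
  fixes A :: "real^'n^'n"
  assumes "\<And>x. A *v x = 0 \<Longrightarrow> x = 0"
  shows "invertible A"
  using assms by (meson invertible_left_inverse matrix_left_invertible_ker)

lemma matrix_inv_vector_mult: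
  fixes A :: "real^'n^'n"
  assumes "invertible A"
  shows "A *v (matrix_inv A *v x) = x" "matrix_inv A *v (A *v x) = x"
proof -
  have "A ** matrix_inv A = mat 1 \<and> matrix_inv A ** A = mat 1"
    using assms unfolding invertible_def matrix_inv_def by (rule someI_ex)
  then show "A *v (matrix_inv A *v x) = x" "matrix_inv A *v (A *v x) = x"
    by (simp_all add: matrix_vector_mul_assoc)
qed

lemma sym_pos_def_invertible: "sym_pos_def V \<Longrightarrow> invertible V"
  by (rule invertible_if_kernel_trivial) (metis inner_zero_right sym_pos_def_eq_0_iff)

lemma ones_neq_0: "(ones :: real^'n) \<noteq> 0"
  by (simp add: ones_def vec_eq_iff)

section \<open>The matrix \<open>D_mat V\<close> as an operator and as a quadratic form\<close>

lemma columnvector_rowvector_mult: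
  "((columnvector x :: real^1^'n) ** rowvector y) *v z = (y \<bullet> z) *\<^sub>R x"
  by (simp add: vec_eq_iff matrix_matrix_mult_def matrix_vector_mult_def columnvector_def
      rowvector_def inner_vec_def sum_distrib_left sum_distrib_right mult_ac)

lemma D_mat_mult:
  fixes V :: "real^'n^'n"
  shows "D_mat V *v x = (1/2) *\<^sub>R ((ones \<bullet> x) *\<^sub>R diag_vec V + (diag_vec V \<bullet> x) *\<^sub>R ones) - V *v x"
proof -
  have scale: "(c *\<^sub>R A) *v x = c *\<^sub>R (A *v x)" for c :: real and A :: "real^'n^'n"
    by (simp add: scaleR_matrix_vector_assoc)
  show ?thesis
    unfolding D_mat_def
    by (simp only: matrix_vector_mult_diff_rdistrib matrix_vector_mult_add_rdistrib scale
        columnvector_rowvector_mult)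
qed

text \<open>Two cases matter: where \<open>ones \<bullet> x = 0\<close> the form is minus that of
  \<open>V\<close>, hence negative definite; where \<open>ones \<bullet> x = 1\<close> it is twice
  the diversification return.\<close>

lemma D_mat_quadratic:
  "x \<bullet> (D_mat V *v x) = (ones \<bullet> x) * (diag_vec V \<bullet> x) - x \<bullet> (V *v x)"
  by (simp add: D_mat_mult inner_diff_right inner_add_right inner_commute)

text \<open>This is the closed form of \<open>w_mdrp V - w_mvp V\<close>, written without
  \<open>D_mat\<close> so that it can be studied before \<open>D_mat V\<close> is known to be
  invertible.\<close>

definition mdrp_direction :: "real^'n^'n \<Rightarrow> real^'n"
  where "mdrp_direction V = (1/2) *\<^sub>R (matrix_inv V *v diag_vec V
    - ((ones \<bullet> (matrix_inv V *v diag_vec V)) / (ones \<bullet> (matrix_inv V *v ones)))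
        *\<^sub>R (matrix_inv V *v ones))"

section \<open>Portfolios for a fixed covariance matrix\<close>

context
  fixes V :: "real^'n^'n"
  assumes spd: "sym_pos_def V"
begin

lemma V_inv_mult: "V *v (matrix_inv V *v x) = x"
  by (rule matrix_inv_vector_mult(1)[OF sym_pos_def_invertible[OF spd]])

lemma inv_ones_pos: "0 < ones \<bullet> (matrix_inv V *v ones)"
proof -
  have "matrix_inv V *v ones \<noteq> 0"
    using V_inv_mult[of ones] ones_neq_0 by force
  then have "0 < (matrix_inv V *v ones) \<bullet> (V *v (matrix_inv V *v ones))"
    using spd unfolding sym_pos_def_def by blast
  then show ?thesis
    by (simp add: V_inv_mult inner_commute)
qed

lemma ones_w_mvp: "ones \<bullet> w_mvp V = 1"
  using inv_ones_pos by (simp add: w_mvp_def)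

lemma V_w_mvp: "V *v w_mvp V = (sigma_mvp V)\<^sup>2 *\<^sub>R ones"
  using inv_ones_pos
  by (simp add: w_mvp_def sigma_mvp_def matrix_vector_mult_scaleR V_inv_mult)

lemma ones_mdrp_direction: "ones \<bullet> mdrp_direction V = 0"
  using inv_ones_pos by (simp add: mdrp_direction_def inner_diff_right)

lemma V_mdrp_direction:
  obtains c where "V *v mdrp_direction V = (1/2) *\<^sub>R diag_vec V - c *\<^sub>R ones"
proof
  let ?c = "(ones \<bullet> (matrix_inv V *v diag_vec V)) / (ones \<bullet> (matrix_inv V *v ones))"
  show "V *v mdrp_direction V = (1/2) *\<^sub>R diag_vec V - (?c / 2) *\<^sub>R ones"
    by (simp add: mdrp_direction_def matrix_vector_mult_scaleR matrix_vector_mult_diff_distrib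
        V_inv_mult scaleR_diff_right)
qed

lemma inner_V_mdrp_direction:
  assumes "ones \<bullet> x = 0"
  shows "x \<bullet> (V *v mdrp_direction V) = (diag_vec V \<bullet> x) / 2"
proof -
  obtain c where "V *v mdrp_direction V = (1/2) *\<^sub>R diag_vec V - c *\<^sub>R ones"
    by (rule V_mdrp_direction)
  then show ?thesis
    using assms by (simp add: inner_diff_right inner_commute)
qed

text \<open>The radicand in \<open>rho\<close> is the \<open>V\<close>-norm of
  \<open>2 *\<^sub>R mdrp_direction V\<close> squared. It is therefore nonnegative, and
  \<open>sqrt\<close> is a genuine root here.\<close>

lemma rho_nonneg_square:
  "0 \<le> rho V \<and> (rho V)\<^sup>2 = 4 * (mdrp_direction V \<bullet> (V *v mdrp_direction V))"
proof -
  let ?p = "matrix_inv V *v ones" and ?r = "matrix_inv V *v diag_vec V"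
  let ?e = "diag_vec V \<bullet> ?r - (ones \<bullet> ?r)\<^sup>2 / (ones \<bullet> ?p)"
  have "?r \<bullet> ones = ?p \<bullet> diag_vec V"
    using sym_pos_def_inner_commute[OF spd, of ?r ?p] by (simp add: V_inv_mult)
  then have "diag_vec V \<bullet> ?p = ones \<bullet> ?r"
    by (simp add: inner_commute)
  then have "diag_vec V \<bullet> mdrp_direction V = ?e / 2"
    by (simp add: mdrp_direction_def inner_diff_right power2_eq_square)
  then have e: "?e = 4 * (mdrp_direction V \<bullet> (V *v mdrp_direction V))"
    using inner_V_mdrp_direction[OF ones_mdrp_direction] by simp
  then have "0 \<le> ?e"
    using sym_pos_def_nonneg[OF spd] by simp
  then show ?thesis
    unfolding rho_def using e by simp
qed

text \<open>Pythagoras: \<open>V *v w_mvp V\<close> is a multiple of \<open>ones\<close>, so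
  \<open>w_mvp V\<close> is \<open>V\<close>-orthogonal to every zero-sum direction.\<close>

lemma variance_w_mvp_add:
  assumes "ones \<bullet> x = 0"
  shows "(w_mvp V + x) \<bullet> (V *v (w_mvp V + x)) = (sigma_mvp V)\<^sup>2 + x \<bullet> (V *v x)"
proof -
  have "x \<bullet> (V *v w_mvp V) = 0" "w_mvp V \<bullet> (V *v w_mvp V) = (sigma_mvp V)\<^sup>2"
    using assms ones_w_mvp by (simp_all add: V_w_mvp inner_commute)
  then show ?thesis
    using sym_pos_def_quadratic_add[OF spd, of "w_mvp V" 1 x]
      sym_pos_def_inner_commute[OF spd, of "w_mvp V" x] by simp
qed

text \<open>Since the portfolio has coordinate sum 1, \<open>D_mat V\<close> contributes exactly
  half of \<open>diag_vec V\<close>, which \<open>V *v mdrp_direction V\<close> cancels up to a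
  multiple of \<open>ones\<close>. This is the Lagrange condition for maximising the diversification
  return under the budget constraint.\<close>

lemma D_mat_mdrp:
  obtains k where "D_mat V *v (w_mvp V + mdrp_direction V) = k *\<^sub>R ones"
proof -
  obtain c where c: "V *v mdrp_direction V = (1/2) *\<^sub>R diag_vec V - c *\<^sub>R ones"
    by (rule V_mdrp_direction)
  let ?w = "w_mvp V + mdrp_direction V"
  have "D_mat V *v ?w = ((diag_vec V \<bullet> ?w) / 2 - (sigma_mvp V)\<^sup>2 + c) *\<^sub>R ones"
    by (simp add: D_mat_mult inner_add_right ones_w_mvp ones_mdrp_direction
        matrix_vector_right_distrib V_w_mvp c algebra_simps add_divide_distrib)
  then show ?thesis by (rule that)
qed

text \<open>Here \<open>k\<close> is twice the maximal diversification return.  Each asset alone has return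
  zero, and by strict concavity they cannot all be maximisers unless there is only one asset,
  in which case \<open>rho V = 0\<close>.\<close>

lemma D_mat_mdrp_pos:
  assumes rho: "rho V \<noteq> 0"
  obtains k where "0 < k" "D_mat V *v (w_mvp V + mdrp_direction V) = k *\<^sub>R ones"
proof -
  let ?w = "w_mvp V + mdrp_direction V"
  obtain k where k: "D_mat V *v ?w = k *\<^sub>R ones"
    by (rule D_mat_mdrp)
  have w1: "ones \<bullet> ?w = 1"
    by (simp add: inner_add_right ones_w_mvp ones_mdrp_direction)
  \<comment> \<open>All single assets lie at the same \<open>V\<close>-distance from
    \<open>?w\<close>. The difference \<open>axis i 1 - ?w\<close> has zero sum, so its
    \<open>D_mat V\<close>-form is minus its \<open>V\<close>-form; expanding the former gives 0 -
    2k + k, as a single asset has diversification return zero.\<close>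
  have k_axis: "k = (axis i 1 - ?w) \<bullet> (V *v (axis i 1 - ?w))" for i
  proof -
    let ?e = "axis i 1 :: real^'n"
    have e1: "ones \<bullet> ?e = 1"
      by (simp add: ones_def inner_axis)
    have "?e \<bullet> (V *v ?e) = diag_vec V \<bullet> ?e"
      by (simp add: matrix_vector_mult_basis inner_axis inner_axis' column_def diag_vec_def)
    moreover have "?e \<bullet> (D_mat V *v ?w) = k" "?w \<bullet> (D_mat V *v ?w) = k"
      using e1 w1 by (simp_all only: k inner_scaleR_right inner_commute[of _ ones])
    moreover have "(?e - ?w) \<bullet> (V *v (?e - ?w))
        = ?e \<bullet> (V *v ?e) - 2 * (?e \<bullet> (V *v ?w)) + ?w \<bullet> (V *v ?w)"
      using sym_pos_def_quadratic_add[OF spd, of ?e "-1" ?w]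
      by (simp only: scaleR_minus1_left add_uminus_conv_diff power2_minus one_power2)
    moreover have "?e \<bullet> (D_mat V *v ?w)
        = (diag_vec V \<bullet> ?e + diag_vec V \<bullet> ?w) / 2 - ?e \<bullet> (V *v ?w)"
      unfolding D_mat_mult w1 using e1
      by (simp add: inner_diff_right inner_add_left[of _ _ ?e] inner_commute[of ?e])
    ultimately show ?thesis
      unfolding D_mat_quadratic w1 by argo
  qed
  have "k \<noteq> 0"
  proof
    assume "k = 0"
    then have "axis i 1 = ?w" for i
      using k_axis[of i] sym_pos_def_eq_0_iff[OF spd] by simp
    \<comment> \<open>If all axis vectors coincide, every vector has equal coordinates, and such a
      vector with zero sum vanishes. No case distinction on the dimension is needed.\<close>
    then have "mdrp_direction V $ i = mdrp_direction V \<bullet> ?w" for i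
      using inner_axis[of "mdrp_direction V" i "1::real"] by simp
    then have "mdrp_direction V = (mdrp_direction V \<bullet> ?w) *\<^sub>R ones"
      by (simp add: vec_eq_iff ones_def)
    moreover from this have "(mdrp_direction V \<bullet> ?w) * (ones \<bullet> (ones :: real^'n)) = 0"
      using ones_mdrp_direction by (metis inner_scaleR_right)
    ultimately have "mdrp_direction V = 0"
      using ones_neq_0 by fastforce
    then show False
      using rho rho_nonneg_square by simp
  qed
  moreover have "0 \<le> k"
    by (subst k_axis) (rule sym_pos_def_nonneg[OF spd])
  ultimately show ?thesis
    using k by (intro that) auto
qed

lemma w_mdrp_eq:
  assumes "rho V \<noteq> 0"
  shows "w_mdrp V = w_mvp V + mdrp_direction V"
proof -
  let ?w = "w_mvp V + mdrp_direction V"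
  obtain k where k: "0 < k" "D_mat V *v ?w = k *\<^sub>R ones"
    using D_mat_mdrp_pos[OF assms] .
  have w1: "ones \<bullet> ?w = 1"
    by (simp add: inner_add_right ones_w_mvp ones_mdrp_direction)
  have "invertible (D_mat V)"
  proof (rule invertible_if_kernel_trivial)
    fix x assume x: "D_mat V *v x = 0"
    \<comment> \<open>Split off the zero-sum part \<open>y\<close> of a kernel vector. Then
      \<open>D_mat V *v y\<close> is a multiple of \<open>ones\<close>, hence orthogonal to
      \<open>y\<close>, and negative definiteness on zero-sum vectors gives \<open>y = 0\<close>;
      now k > 0 forces \<open>t = 0\<close>.\<close>
    define t y where "t = ones \<bullet> x" and "y = x - t *\<^sub>R ?w"
    have y1: "ones \<bullet> y = 0"
      unfolding y_def t_def inner_diff_right inner_scaleR_right w1 by simp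
    have Dy: "D_mat V *v y = - (t * k) *\<^sub>R ones"
      unfolding y_def matrix_vector_mult_diff_distrib matrix_vector_mult_scaleR x k(2) by simp
    have "y \<bullet> (D_mat V *v y) = 0"
      unfolding Dy using y1 by (simp add: inner_commute)
    then have "y = 0"
      using y1 sym_pos_def_eq_0_iff[OF spd] by (simp add: D_mat_quadratic)
    moreover from this have "t = 0"
      using Dy k(1) ones_neq_0 by auto
    ultimately show "x = 0"
      by (simp add: y_def)
  qed
  then have "?w = k *\<^sub>R (matrix_inv (D_mat V) *v ones)"
    using matrix_inv_vector_mult(2) k(2) by (metis matrix_vector_mult_scaleR)
  moreover from this have "k * (ones \<bullet> (matrix_inv (D_mat V) *v ones)) = 1"
    using w1 by (metis inner_scaleR_right)
  then have "1 / (ones \<bullet> (matrix_inv (D_mat V) *v ones)) = k"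
    using k(1) by (auto simp: divide_eq_eq)
  ultimately show ?thesis
    unfolding w_mdrp_def by simp
qed

end

theorem theorem8:
  fixes V :: "real^'n^'n" and \<sigma> \<alpha> :: real
  assumes "sym_pos_def V"
    and "rho V \<noteq> 0"
    and "\<sigma> \<ge> sigma_mvp V"
  defines "\<alpha> \<equiv> 2 / rho V * sqrt (\<sigma>\<^sup>2 - (sigma_mvp V)\<^sup>2)"
  shows "{w. is_arg_max (div_return V) (\<lambda>w. ones \<bullet> w = 1 \<and> w \<bullet> (V *v w) = \<sigma>\<^sup>2) w}
         = {\<alpha> *\<^sub>R w_mdrp V + (1 - \<alpha>) *\<^sub>R w_mvp V}"
proof -
  note spd = assms(1)
  let ?P = "\<lambda>w. ones \<bullet> w = 1 \<and> w \<bullet> (V *v w) = \<sigma>\<^sup>2"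
  let ?u = "mdrp_direction V" and ?m = "w_mvp V"
  let ?w = "?m + \<alpha> *\<^sub>R ?u"
  have rho: "0 < rho V"
    using rho_nonneg_square[OF spd] assms(2) by simp
  have mvp0: "0 \<le> sigma_mvp V"
    using inv_ones_pos[OF spd] by (simp add: sigma_mvp_def)
  have s0: "0 \<le> \<sigma>\<^sup>2 - (sigma_mvp V)\<^sup>2"
    using assms(3) mvp0 by (simp add: power_mono)
  have \<alpha>0: "0 \<le> \<alpha>"
    using rho s0 by (simp add: \<alpha>_def)
  have \<alpha>_sq: "\<alpha>\<^sup>2 * (?u \<bullet> (V *v ?u)) = \<sigma>\<^sup>2 - (sigma_mvp V)\<^sup>2"
  proof -
    have "\<alpha>\<^sup>2 * (rho V)\<^sup>2 = 4 * (\<sigma>\<^sup>2 - (sigma_mvp V)\<^sup>2)"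
      using rho s0 by (simp add: \<alpha>_def power_mult_distrib power_divide)
    then show ?thesis
      using rho_nonneg_square[OF spd] by simp
  qed
  have u1: "ones \<bullet> (\<alpha> *\<^sub>R ?u) = 0"
    by (simp add: ones_mdrp_direction[OF spd])
  have Pw: "?P ?w"
    using variance_w_mvp_add[OF spd u1] \<alpha>_sq u1 ones_w_mvp[OF spd]
    by (simp add: inner_add_right matrix_vector_mult_scaleR power2_eq_square)
  text \<open>The identity stays informative for \<open>\<alpha> = 0\<close>: the right-hand side then vanishes,
    so the feasible set is the single point \<open>w_mvp\<close>.\<close>
  have gap: "\<alpha> * (2 * (div_return V ?w - div_return V w)) = (w - ?w) \<bullet> (V *v (w - ?w))"
    if "?P w" for w
  proof -
    define x where "x = w - ?m"
    have w: "w = ?m + x" and x1: "ones \<bullet> x = 0"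
      using that ones_w_mvp[OF spd] by (simp_all add: x_def inner_diff_right)
    have xx: "x \<bullet> (V *v x) = \<sigma>\<^sup>2 - (sigma_mvp V)\<^sup>2"
      using variance_w_mvp_add[OF spd x1] that w by simp
    \<comment> \<open>Both portfolios have variance \<open>\<sigma>\<^sup>2\<close>, so the
      quadratic terms cancel and only the linear terms remain.\<close>
    have "2 * (div_return V ?w - div_return V w) = \<alpha> * (diag_vec V \<bullet> ?u) - diag_vec V \<bullet> x"
      using that Pw unfolding div_return_def
      by (simp add: w inner_add_right diff_divide_distrib add_divide_distrib)
    also have "\<dots> = 2 * (\<alpha> * (?u \<bullet> (V *v ?u)) - x \<bullet> (V *v ?u))"
      using inner_V_mdrp_direction[OF spd x1]
        inner_V_mdrp_direction[OF spd ones_mdrp_direction[OF spd]]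
      by (simp add: algebra_simps)
    finally have "\<alpha> * (2 * (div_return V ?w - div_return V w))
        = 2 * (\<alpha>\<^sup>2 * (?u \<bullet> (V *v ?u))) - 2 * \<alpha> * (x \<bullet> (V *v ?u))"
      by (simp only:) (simp add: algebra_simps power2_eq_square)
    \<comment> \<open>Cauchy-Schwarz with its equality case: \<open>x\<close> and
      \<open>\<alpha> *\<^sub>R ?u\<close> have equal \<open>V\<close>-norm, so one of the two
      copies of the squared norm may be read as that of \<open>x\<close>, which completes the
      square.\<close>
    also have "\<dots> = (x + (-\<alpha>) *\<^sub>R ?u) \<bullet> (V *v (x + (-\<alpha>) *\<^sub>R ?u))"
      unfolding sym_pos_def_quadratic_add[OF spd] xx using \<alpha>_sq by simp
    also have "x + (-\<alpha>) *\<^sub>R ?u = w - ?w"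
      by (simp add: w)
    finally show ?thesis .
  qed
  have unique: "div_return V w < div_return V ?w" if "?P w" "w \<noteq> ?w" for w
  proof -
    have "0 < (w - ?w) \<bullet> (V *v (w - ?w))"
      using spd that(2) unfolding sym_pos_def_def by simp
    then have "0 < \<alpha> * (2 * (div_return V ?w - div_return V w))"
      by (simp only: gap[OF that(1)])
    \<comment> \<open>A strictly positive product also rules out \<alpha> = 0, so the degenerate
      case needs no separate treatment.\<close>
    then show ?thesis
      using \<alpha>0 by (simp add: zero_less_mult_iff)
  qed
  have "is_arg_max (div_return V) ?P w \<longleftrightarrow> w = ?w" for w
    unfolding is_arg_max_def using Pw unique by (metis less_asym' less_irrefl)
  moreover have "\<alpha> *\<^sub>R w_mdrp V + (1 - \<alpha>) *\<^sub>R ?m = ?w"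
    by (simp add: w_mdrp_eq[OF spd assms(2)] algebra_simps)
  ultimately show ?thesis by simp
qed

end
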